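(* There is an absolute constant $C$ such that for every integer $n \ge 1$, $$D(n) \le \frac{7n}{8} + C.$$
   Context: Let $P$ be a finite set of points in the plane. A disk (of positive radius) is empty (with respect to $P$) if its interior contains no point of $P$. Disks are called pairwise-disjoint if their interiors are pairwise disjoint (so two disks may touch at a common boundary point). $D(P)$ is the minimum number of disks in a family of pairwise-disjoint empty disks such that each point of $P$ lies on the boundary of at least one disk of the family. $D(n)$ is the maximum of $D(P)$ over all sets $P$ of $n$ points in the plane. *)

theory Defs
  imports "HOL-Analysis.Analysis"
begin

definition is_disk :: "(real ^ 2) set \<Rightarrow> bool" where
  "is_disk A \<longleftrightarrow> (\<exists>c r. r > 0 \<and> A = cball c r)"

definition empty_disk :: "(real ^ 2) set \<Rightarrow> (real ^ 2) set \<Rightarrow> bool" where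
  "empty_disk P A \<longleftrightarrow> is_disk A \<and> interior A \<inter> P = {}"

definition disjoint_disks :: "(real ^ 2) set set \<Rightarrow> bool" where
  "disjoint_disks F \<longleftrightarrow> pairwise (\<lambda>A B. disjnt (interior A) (interior B)) F"

definition disk_cover :: "(real ^ 2) set \<Rightarrow> (real ^ 2) set set \<Rightarrow> bool" where
  "disk_cover P F \<longleftrightarrow>
     finite F \<and> (\<forall>A\<in>F. empty_disk P A) \<and> disjoint_disks F \<and>
     (\<forall>p\<in>P. \<exists>A\<in>F. p \<in> frontier A)"

definition D_set :: "(real ^ 2) set \<Rightarrow> nat" where
  "D_set P = (LEAST k. \<exists>F. disk_cover P F \<and> card F = k)"

definition D :: "nat \<Rightarrow> nat" where
  "D n = Max {D_set P | P. finite P \<and> card P = n}"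

text \<open>The minimum and the maximum above exist: small disks touching the points, one for each
  point, form an admissible family.\<close>

lemma disk_cover_exists:
  assumes "finite P"
  shows "\<exists>F. disk_cover P F \<and> card F \<le> card P"
proof -
  obtain d where d: "d > 0" "\<And>p q. p \<in> P \<Longrightarrow> q \<in> P \<Longrightarrow> p \<noteq> q \<Longrightarrow> d \<le> dist p q"
  proof (cases "\<exists>p\<in>P. \<exists>q\<in>P. p \<noteq> q")
    case True
    let ?S = "(\<lambda>(p, q). dist p q) ` {(p, q) \<in> P \<times> P. p \<noteq> q}"
    have fin: "finite ?S"
      using assms by (intro finite_imageI) (auto intro: finite_subset[of _ "P \<times> P"])
    have ne: "?S \<noteq> {}" using True by auto
    have "Min ?S > 0" using fin ne by (subst Min_gr_iff) auto
    moreover have "Min ?S \<le> dist p q" if "p \<in> P" "q \<in> P" "p \<noteq> q" for p q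
      using fin that by (intro Min_le) auto
    ultimately show ?thesis using that by blast
  next
    case False
    then show ?thesis using that[of 1] by auto
  qed
  define v :: "real ^ 2" where "v = (d / 4) *\<^sub>R axis 1 1"
  have nv: "norm v = d / 4" using d(1) by (simp add: v_def)
  define f where "f p = cball (p + v) (d / 4)" for p
  have int: "interior (f p) = ball (p + v) (d / 4)" for p
    by (simp add: f_def interior_cball)
  have near: "dist p x < d / 2" if "x \<in> interior (f p)" for p x
  proof -
    have "dist p x \<le> dist p (p + v) + dist (p + v) x" by (rule dist_triangle)
    moreover have "dist p (p + v) = d / 4" using nv by (simp add: dist_norm)
    ultimately show ?thesis using that by (simp add: int)
  qed
  have "empty_disk P (f p)" if p: "p \<in> P" for p
  proof -
    have "q \<notin> P" if q: "q \<in> interior (f p)" for q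
    proof
      assume "q \<in> P"
      moreover have "p \<noteq> q" using q nv by (auto simp: int dist_norm)
      ultimately show False using d(2)[OF p, of q] near[OF q] d(1) by auto
    qed
    moreover have "is_disk (f p)"
      unfolding is_disk_def f_def using d(1) by (intro exI[of _ "p + v"] exI[of _ "d / 4"]) simp
    ultimately show ?thesis by (auto simp: empty_disk_def)
  qed
  moreover have "disjoint_disks (f ` P)"
  proof -
    have "disjnt (interior (f p)) (interior (f q))" if pq: "p \<in> P" "q \<in> P" "f p \<noteq> f q" for p q
    proof (rule ccontr)
      assume "\<not> ?thesis"
      then obtain x where x: "x \<in> interior (f p)" "x \<in> interior (f q)"
        by (auto simp: disjnt_iff)
      have "dist p q \<le> dist p x + dist q x" by (metis dist_triangle dist_commute)
      also have "\<dots> < d" using near[OF x(1)] near[OF x(2)] by simp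
      finally show False using d(2)[OF pq(1,2)] pq(3) by auto
    qed
    then show ?thesis by (auto simp: disjoint_disks_def pairwise_def)
  qed
  moreover have "p \<in> frontier (f p)" for p
    using d(1) nv by (simp add: f_def frontier_cball dist_norm)
  ultimately have "disk_cover P (f ` P)"
    using assms by (auto simp: disk_cover_def)
  then show ?thesis using assms card_image_le by blast
qed

lemma D_set_attained:
  assumes "finite P"
  shows "\<exists>F. disk_cover P F \<and> card F = D_set P"
  unfolding D_set_def by (rule LeastI_ex) (use disk_cover_exists[OF assms] in blast)

lemma D_set_le: "disk_cover P F \<Longrightarrow> D_set P \<le> card F"
  unfolding D_set_def by (rule Least_le) blast

lemma finite_D_sets: "finite {D_set P | P. finite P \<and> card P = n}"
proof (rule finite_subset)
  show "{D_set P | P. finite P \<and> card P = n} \<subseteq> {..n}"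
    using disk_cover_exists D_set_le by (fastforce intro: order_trans)
qed simp

lemma D_attained: "\<exists>P. finite P \<and> card P = n \<and> D_set P = D n"
proof -
  have "infinite (ball (0 :: real ^ 2) 1)"
    by (simp add: uncountable_ball uncountable_infinite)
  then obtain P :: "(real ^ 2) set" where "finite P" "card P = n"
    using infinite_arbitrarily_large by blast
  then have "{D_set P | P. finite P \<and> card P = n} \<noteq> {}" by blast
  from Max_in[OF finite_D_sets this] show ?thesis by (auto simp: D_def)
qed

lemma D_set_le_D: "finite P \<Longrightarrow> D_set P \<le> D (card P)"
  unfolding D_def by (rule Max_ge[OF finite_D_sets]) blast

end

theory Submission
  imports Defs
begin

text \<open>Call a disk good if its interior misses \<open>P\<close> and its boundary carries at least two points of \<open>P\<close>.
  Disjoint good disks, together with tiny disks at the points that they miss, save one disk per good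
  disk, so it suffices to find \<open>m \<ge> (n - 1) / 8\<close> pairwise disjoint good disks. Choose them greedily,
  always almost the smallest available one. Then every good disk meets a chosen disk that is at most
  slightly larger, and hence contains one of eight points placed suitably around that chosen disk.

  It remains to see that a set \<open>S\<close> disjoint from \<open>P\<close> that meets the interior of every good disk has at
  least \<open>n - 1\<close> points. In the Voronoi diagram of \<open>P \<union> S\<close> no two cells of points of \<open>P\<close> share
  an edge. So from each \<open>x \<in> P\<close> almost every direction either is an outer normal of the convex hull of \<open>P\<close>
  at \<open>x\<close> or leads to a Voronoi edge shared with some \<open>s \<in> S\<close>. That edge is seen from \<open>x\<close> and
  from \<open>s\<close> under the same angle, by reflection, and the angles seen from one \<open>s\<close> add up to at most a full
  turn, as do the angles of the outer normals. Summing over \<open>x\<close> gives \<open>n \<le> card S + 1\<close>.\<close>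

section \<open>Inversion and Voronoi cones\<close>

text \<open>The component along \<open>v\<close> of the image of \<open>y\<close> under inversion at \<open>a\<close>. It decides when the growing
  sphere through \<open>a\<close> with centre on the ray from \<open>a\<close> in direction \<open>v\<close> reaches \<open>y\<close>.\<close>

definition inv_height :: "'a::real_inner \<Rightarrow> 'a \<Rightarrow> 'a \<Rightarrow> real" where
  "inv_height a y v = ((y - a) \<bullet> v) / (norm (y - a))\<^sup>2"

lemma inv_height_inner: "inv_height a y v = ((1 / (norm (y - a))\<^sup>2) *\<^sub>R (y - a)) \<bullet> v"
  by (simp add: inv_height_def)

text \<open>For \<open>k > 0\<close> the sphere with this centre and radius
  \<open>norm v / (2 * k)\<close> passes through \<open>a\<close>, and the last summand is the power
  of \<open>y\<close> with respect to it.\<close>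

lemma dist_center_sq:
  fixes a y v :: "'a::real_inner"
  assumes "y \<noteq> a" "k \<noteq> 0"
  shows "(dist (a + (1 / (2 * k)) *\<^sub>R v) y)\<^sup>2
    = (norm v / (2 * k))\<^sup>2 + (norm (y - a))\<^sup>2 * (1 - inv_height a y v / k)"
proof -
  define w where "w = y - a"
  have "dist (a + (1 / (2 * k)) *\<^sub>R v) y = norm (w - (1 / (2 * k)) *\<^sub>R v)"
    by (simp add: dist_norm norm_minus_commute w_def algebra_simps)
  then have "(dist (a + (1 / (2 * k)) *\<^sub>R v) y)\<^sup>2 = (norm (w - (1 / (2 * k)) *\<^sub>R v))\<^sup>2"
    by simp
  also have "\<dots> = (norm w)\<^sup>2 - (w \<bullet> v) / k + (norm v / (2 * k))\<^sup>2"
    using assms(2)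
    by (simp add: power2_norm_eq_inner power_divide inner_diff_left inner_diff_right inner_commute
        field_simps power2_eq_square[of k])
  finally have "(dist (a + (1 / (2 * k)) *\<^sub>R v) y)\<^sup>2
    = (norm (y - a))\<^sup>2 - ((y - a) \<bullet> v) / k + (norm v / (2 * k))\<^sup>2"
    by (simp only: w_def)
  also have "((y - a) \<bullet> v) / k = (norm (y - a))\<^sup>2 * (inv_height a y v / k)"
    using assms by (simp add: inv_height_def)
  finally show ?thesis by (simp add: algebra_simps)
qed

text \<open>For nonzero \<open>v\<close>, inversion at \<open>a\<close> turns this sphere into the
  hyperplane at height \<open>k\<close>. A larger \<open>k\<close> means a smaller sphere, so the
  growing sphere meets points in order of decreasing height.\<close>

lemma
  fixes a y v :: "'a::real_inner"
  assumes "y \<noteq> a" "k > 0"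
  shows inv_height_le_iff:
      "inv_height a y v \<le> k \<longleftrightarrow> norm v / (2 * k) \<le> dist (a + (1 / (2 * k)) *\<^sub>R v) y"
    and inv_height_eq_iff:
      "inv_height a y v = k \<longleftrightarrow> norm v / (2 * k) = dist (a + (1 / (2 * k)) *\<^sub>R v) y"
proof -
  let ?d = "dist (a + (1 / (2 * k)) *\<^sub>R v) y" and ?r = "norm v / (2 * k)"
  let ?e = "(norm (y - a))\<^sup>2 * (1 - inv_height a y v / k)"
  have eq: "?d\<^sup>2 = ?r\<^sup>2 + ?e"
    using dist_center_sq[of y a k v] assms by simp
  have r: "0 \<le> ?r" using assms by simp
  have pos: "(norm (y - a))\<^sup>2 > 0" using assms by simp
  have "inv_height a y v \<le> k \<longleftrightarrow> 0 \<le> 1 - inv_height a y v / k" using assms by (simp add: field_simps)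
  also have "\<dots> \<longleftrightarrow> 0 \<le> ?e" using pos by (metis mult_le_cancel_left_pos mult_zero_right)
  also have "\<dots> \<longleftrightarrow> ?r\<^sup>2 \<le> ?d\<^sup>2" using eq by linarith
  also have "\<dots> \<longleftrightarrow> ?r \<le> ?d" using r by (meson abs_le_square_iff power2_le_imp_le power_mono zero_le_dist)
  finally show "inv_height a y v \<le> k \<longleftrightarrow> ?r \<le> ?d" .
  have "inv_height a y v = k \<longleftrightarrow> 1 - inv_height a y v / k = 0" using assms by (auto simp: field_simps)
  also have "\<dots> \<longleftrightarrow> ?e = 0" using pos by (metis mult_eq_0_iff less_irrefl)
  also have "\<dots> \<longleftrightarrow> ?r\<^sup>2 = ?d\<^sup>2" using eq by linarith
  also have "\<dots> \<longleftrightarrow> ?r = ?d" using r by (metis power2_eq_imp_eq zero_le_dist)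
  finally show "inv_height a y v = k \<longleftrightarrow> ?r = ?d" .
qed

definition reflect :: "'a::real_inner \<Rightarrow> 'a \<Rightarrow> 'a" where
  "reflect w v = v - (2 * (v \<bullet> w) / (w \<bullet> w)) *\<^sub>R w"

lemma orthogonal_transformation_reflect: "orthogonal_transformation (reflect w)"
proof (cases "w = 0")
  case True
  then have "reflect w = (\<lambda>v. v)" by (simp add: reflect_def fun_eq_iff)
  then show ?thesis by (simp add: orthogonal_transformation_id)
next
  case False
  have "linear (reflect w)"
    unfolding reflect_def
    by (intro linearI) (simp_all add: inner_add_left algebra_simps add_divide_distrib scaleR_add_left)
  moreover have "reflect w u \<bullet> reflect w v = u \<bullet> v" for u v
    using False
    by (simp add: reflect_def inner_diff_left inner_diff_right inner_commute divide_simps)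
  ultimately show ?thesis by (simp add: orthogonal_transformation_def)
qed

text \<open>The directions in which the ray from \<open>a\<close> leaves its Voronoi cell through the edge shared with \<open>b\<close>,
  as a cone cut off by the unit ball, so that Lebesgue measure stands in for angle.\<close>

definition vcone :: "'a::real_inner set \<Rightarrow> 'a \<Rightarrow> 'a \<Rightarrow> 'a set" where
  "vcone Z a b = {v \<in> ball 0 1. 0 < inv_height a b v \<and>
     (\<forall>y\<in>Z - {a}. inv_height a y v \<le> inv_height a b v)}"

lemma vcone_subset_ball: "vcone Z a b \<subseteq> ball 0 1"
  by (auto simp: vcone_def)

text \<open>Each \<open>v\<close> in the cone yields a sphere through \<open>a\<close> and
  \<open>b\<close> with no point of \<open>Z\<close> inside. Its centre lies on the bisector, so
  reflection carries the ray from \<open>a\<close> through it to the ray from \<open>b\<close>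
  through it, and emptiness looks the same from either end.\<close>

lemma reflect_vcone:
  assumes "a \<in> Z" "b \<in> Z" "a \<noteq> b"
  shows "reflect (b - a) ` vcone Z a b \<subseteq> vcone Z b a"
proof (rule image_subsetI)
  fix v assume v: "v \<in> vcone Z a b"
  define w where "w = b - a"
  define u where "u = reflect w v"
  define k where "k = inv_height a b v"
  have w0: "w \<noteq> 0" using assms by (simp add: w_def)
  have k: "k > 0" and nv: "norm v < 1" using v by (auto simp: vcone_def k_def)
  have nu: "norm u = norm v"
    using orthogonal_transformation_reflect[of w] by (simp add: u_def orthogonal_transformation_norm)
  have kw: "v \<bullet> w = k * (w \<bullet> w)"
    using w0 by (simp add: k_def inv_height_def w_def[symmetric] inner_commute power2_norm_eq_inner)
  have u_eq: "u = v - (2 * k) *\<^sub>R w"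
    using w0 by (simp add: u_def reflect_def kw)
  have z: "a + (1 / (2 * k)) *\<^sub>R v = b + (1 / (2 * k)) *\<^sub>R u"
    using k by (simp add: u_eq w_def algebra_simps)
  have *: "inv_height b y u \<le> k" if y: "y \<in> Z - {b}" "y \<noteq> a" for y
  proof -
    have "inv_height a y v \<le> k" using v y by (auto simp: vcone_def k_def)
    then show ?thesis
      using inv_height_le_iff[of y a k v] inv_height_le_iff[of y b k u] y k nu z by simp
  qed
  have "inv_height b a u = k"
    using inv_height_eq_iff[of a b k u] assms k nu z[symmetric] by (simp add: dist_norm)
  then show "reflect (b - a) v \<in> vcone Z b a"
    using * k nu nv unfolding u_def w_def vcone_def by fastforce
qed

lemma vcone_lmeasurable:
  fixes Z :: "'a::euclidean_space set"
  shows "vcone Z a b \<in> lmeasurable"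
proof -
  have "vcone Z a b = ball 0 1 \<inter> {v. 0 < inv_height a b v} \<inter>
      (\<Inter>y\<in>Z - {a}. {v. inv_height a y v \<le> inv_height a b v})"
    by (auto simp: vcone_def)
  also have "\<dots> \<in> sets borel"
    unfolding inv_height_inner
    by (intro sets.Int borel_open[OF open_ball] borel_open[OF open_Collect_less]
        borel_closed[OF closed_INT] ballI closed_Collect_le continuous_intros)
  finally have "vcone Z a b \<in> sets lebesgue" by auto
  then show ?thesis
    by (meson vcone_subset_ball bounded_ball bounded_set_imp_lmeasurable bounded_subset)
qed

lemma measure_vcone_le:
  fixes Z :: "(real^'n::{finite,wellorder}) set"
  assumes "a \<in> Z" "b \<in> Z" "a \<noteq> b"
  shows "measure lebesgue (vcone Z a b) \<le> measure lebesgue (vcone Z b a)"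
proof -
  have "measure lebesgue (vcone Z a b) = measure lebesgue (reflect (b - a) ` vcone Z a b)"
    by (rule measure_orthogonal_image[OF orthogonal_transformation_reflect vcone_lmeasurable, symmetric])
  also have "\<dots> \<le> measure lebesgue (vcone Z b a)"
    using assms
    by (intro measure_mono_fmeasurable reflect_vcone vcone_lmeasurable fmeasurableD
        measurable_orthogonal_image orthogonal_transformation_reflect)
  finally show ?thesis .
qed

text \<open>The heights in all directions determine the inverted point, and inversion is injective:
  comparing norms gives equal distances from \<open>a\<close>.\<close>

lemma inv_height_inj:
  fixes a x y :: "'a::euclidean_space"
  assumes "x \<noteq> a" "y \<noteq> a" "\<And>v. inv_height a x v = inv_height a y v"
  shows "x = y"
proof -
  let ?i = "\<lambda>y. (1 / (norm (y - a))\<^sup>2) *\<^sub>R (y - a)"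
  have eq: "?i x = ?i y"
    using assms(3) unfolding inv_height_inner by (metis vector_eq_rdot)
  have n: "norm (?i y) = 1 / norm (y - a)" for y
    by (simp add: power2_eq_square)
  have "norm (x - a) = norm (y - a)"
    using arg_cong[OF eq, of norm] unfolding n by simp
  then show ?thesis using eq assms by simp
qed

text \<open>On the overlap both heights are maximal, hence equal, which confines \<open>v\<close> to
  the hyperplane normal to the difference of the inverted points.\<close>

lemma negligible_vcone_Int:
  fixes Z :: "'a::euclidean_space set"
  assumes "x \<in> Z" "y \<in> Z" "x \<noteq> a" "y \<noteq> a" "x \<noteq> y"
  shows "negligible (vcone Z a x \<inter> vcone Z a y)"
proof (rule negligible_subset)
  let ?i = "\<lambda>y. (1 / (norm (y - a))\<^sup>2) *\<^sub>R (y - a)"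
  have "?i x \<noteq> ?i y" using inv_height_inj[of x a y] assms unfolding inv_height_inner by metis
  then show "negligible {v. (?i x - ?i y) \<bullet> v = 0}" by (intro negligible_hyperplane) simp
  show "vcone Z a x \<inter> vcone Z a y \<subseteq> {v. (?i x - ?i y) \<bullet> v = 0}"
    unfolding inner_diff_left inv_height_inner[symmetric]
    using assms by (fastforce simp: vcone_def intro: antisym)
qed

section \<open>Outer normal cones and sums of angles\<close>

definition hull_cone :: "'a::real_inner set \<Rightarrow> 'a \<Rightarrow> 'a set" where
  "hull_cone P x = {v \<in> ball 0 1. \<forall>y\<in>P - {x}. (y - x) \<bullet> v \<le> 0}"

lemma hull_cone_subset_ball: "hull_cone P x \<subseteq> ball 0 1"
  by (auto simp: hull_cone_def)

lemma hull_cone_lmeasurable: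
  fixes P :: "'a::euclidean_space set"
  shows "hull_cone P x \<in> lmeasurable"
proof -
  have "hull_cone P x = ball 0 1 \<inter> (\<Inter>y\<in>P - {x}. {v. (y - x) \<bullet> v \<le> 0})"
    by (auto simp: hull_cone_def)
  also have "\<dots> \<in> sets borel"
    by (intro sets.Int borel_open[OF open_ball] borel_closed[OF closed_INT] ballI
        closed_Collect_le continuous_intros)
  finally have "hull_cone P x \<in> sets lebesgue" by auto
  then show ?thesis
    by (meson hull_cone_subset_ball bounded_ball bounded_set_imp_lmeasurable bounded_subset)
qed

text \<open>A direction that is an outer normal at both points is orthogonal to
  \<open>x - y\<close>.\<close>

lemma negligible_hull_cone_Int:
  fixes P :: "'a::euclidean_space set"
  assumes "x \<in> P" "y \<in> P" "x \<noteq> y"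
  shows "negligible (hull_cone P x \<inter> hull_cone P y)"
proof (rule negligible_subset)
  show "negligible {v. (x - y) \<bullet> v = 0}" using assms by (intro negligible_hyperplane) simp
  show "hull_cone P x \<inter> hull_cone P y \<subseteq> {v. (x - y) \<bullet> v = 0}"
    using assms by (fastforce simp: hull_cone_def inner_diff_left intro: antisym)
qed

lemma sum_measure_le_ball:
  fixes f :: "'i \<Rightarrow> ('a::euclidean_space) set"
  assumes "finite I" "\<And>i. i \<in> I \<Longrightarrow> f i \<in> lmeasurable" "\<And>i. i \<in> I \<Longrightarrow> f i \<subseteq> ball 0 1"
    "pairwise (\<lambda>i j. negligible (f i \<inter> f j)) I"
  shows "(\<Sum>i\<in>I. measure lebesgue (f i)) \<le> measure lebesgue (ball (0::'a) 1)"
proof -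
  have "(\<Sum>i\<in>I. measure lebesgue (f i)) = measure lebesgue (\<Union>(f ` I))"
    using measure_negligible_finite_Union_image[OF assms(1,2,4)] by simp
  also have "\<dots> \<le> measure lebesgue (ball (0::'a) 1)"
    using assms by (intro measure_mono_fmeasurable) (auto intro!: fmeasurableD fmeasurable.finite_UN)
  finally show ?thesis .
qed

section \<open>Counting the points that block all good disks\<close>

definition good_disk :: "'a::metric_space set \<Rightarrow> 'a \<Rightarrow> real \<Rightarrow> bool" where
  "good_disk P c r \<longleftrightarrow> r > 0 \<and> (\<forall>p\<in>P. r \<le> dist c p) \<and>
     (\<exists>a\<in>P. \<exists>b\<in>P. a \<noteq> b \<and> dist c a = r \<and> dist c b = r)"

text \<open>Grow a sphere from \<open>x\<close> in direction \<open>v\<close>. Unless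
  \<open>v\<close> is an outer normal, it reaches a point of \<open>P\<close>; when it first does,
  it bounds a good disk, so it has already passed a point of \<open>S\<close>.\<close>

lemma ball_subset_cones:
  fixes P S :: "'a::euclidean_space set"
  assumes fin: "finite P" "finite S" and disj: "P \<inter> S = {}"
    and block: "\<And>c r. good_disk P c r \<Longrightarrow> \<exists>s\<in>S. dist c s < r"
    and x: "x \<in> P"
  shows "ball 0 1 \<subseteq> hull_cone P x \<union> (\<Union>s\<in>S. vcone (P \<union> S) x s)"
proof
  fix v :: 'a assume v: "v \<in> ball 0 1"
  show "v \<in> hull_cone P x \<union> (\<Union>s\<in>S. vcone (P \<union> S) x s)"
  proof (cases "v \<in> hull_cone P x")
    case False
    then obtain y where y: "y \<in> P - {x}" "(y - x) \<bullet> v > 0"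
      using v by (force simp: hull_cone_def)
    let ?h = "\<lambda>y. inv_height x y v"
    \<comment> \<open>The largest height in \<open>P\<close> belongs to the point \<open>b\<close>
      of \<open>P\<close> that is reached first.\<close>
    define k where "k = Max (?h ` (P - {x}))"
    have k_ge: "?h z \<le> k" if "z \<in> P - {x}" for z
      unfolding k_def using fin that by (intro Max_ge) auto
    have "?h y > 0" using y by (simp add: inv_height_def)
    then have k: "k > 0" using k_ge[OF y(1)] by simp
    obtain b where b: "b \<in> P - {x}" "?h b = k"
    proof -
      have "k \<in> ?h ` (P - {x})" unfolding k_def using fin y by (intro Max_in) auto
      then show ?thesis using that by auto
    qed
    let ?c = "x + (1 / (2 * k)) *\<^sub>R v" and ?r = "norm v / (2 * k)"
    have v0: "v \<noteq> 0" using y by auto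
    have dx: "dist ?c x = ?r" using k by (simp add: dist_norm)
    have "good_disk P ?c ?r"
      unfolding good_disk_def
    proof (intro conjI ballI bexI)
      show "0 < ?r" using v0 k by simp
      show "?r \<le> dist ?c p" if "p \<in> P" for p
        using inv_height_le_iff[of p x k v] k_ge[of p] k that dx by (cases "p = x") auto
      show "x \<noteq> b" using b by auto
      show "dist ?c b = ?r" using inv_height_eq_iff[of b x k v] b k by auto
    qed (use dx x b in auto)
    then obtain s where s: "s \<in> S" "dist ?c s < ?r" using block by blast
    have sx: "s \<noteq> x" using s x disj by auto
    have sk: "?h s > k" using inv_height_le_iff[of s x k v] s k sx by auto
    \<comment> \<open>The maximum over \<open>S\<close> exceeds \<open>k\<close>, so it is also the
      maximum over all of \<open>P \<union> S\<close> without \<open>x\<close>.\<close>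
    define l where "l = Max (?h ` S)"
    have l_ge: "?h z \<le> l" if "z \<in> S" for z
      unfolding l_def using fin that by (intro Max_ge) auto
    obtain t where t: "t \<in> S" "?h t = l"
    proof -
      have "l \<in> ?h ` S" unfolding l_def using fin s by (intro Max_in) auto
      then show ?thesis using that by auto
    qed
    have lk: "k < l" using l_ge[OF s(1)] sk by simp
    have "?h z \<le> l" if "z \<in> (P \<union> S) - {x}" for z
      using that l_ge[of z] k_ge[of z] lk by auto
    then have "v \<in> vcone (P \<union> S) x t"
      using v t lk k by (auto simp: vcone_def)
    then show ?thesis using t by blast
  qed simp
qed

theorem card_le_blockers:
  fixes P S :: "(real^'n::{finite,wellorder}) set"
  assumes fin: "finite P" "finite S" and disj: "P \<inter> S = {}"
    and block: "\<And>c r. good_disk P c r \<Longrightarrow> \<exists>s\<in>S. dist c s < r"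
  shows "card P \<le> card S + 1"
proof -
  let ?Z = "P \<union> S" and ?m = "measure lebesgue :: (real^'n::_) set \<Rightarrow> real"
  let ?B = "measure lebesgue (ball (0 :: real^'n::_) 1)"
  have B: "?B > 0" by (simp add: content_ball_pos measure_completion)
  have "?B \<le> ?m (hull_cone P x) + (\<Sum>s\<in>S. ?m (vcone ?Z x s))" if "x \<in> P" for x
  proof -
    have "?B \<le> ?m (hull_cone P x \<union> (\<Union>s\<in>S. vcone ?Z x s))"
      using ball_subset_cones[OF fin disj block that] fin
      by (intro measure_mono_fmeasurable)
        (auto intro!: fmeasurable.finite_UN fmeasurable.Un vcone_lmeasurable hull_cone_lmeasurable)
    also have "\<dots> \<le> ?m (hull_cone P x) + ?m (\<Union>s\<in>S. vcone ?Z x s)"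
      using fin
      by (intro measure_Un_le fmeasurableD)
        (auto intro!: fmeasurable.finite_UN vcone_lmeasurable hull_cone_lmeasurable)
    also have "?m (\<Union>s\<in>S. vcone ?Z x s) \<le> (\<Sum>s\<in>S. ?m (vcone ?Z x s))"
      using fin by (intro measure_UNION_le) (auto intro!: fmeasurableD vcone_lmeasurable)
    finally show ?thesis by simp
  qed
  then have "(\<Sum>x\<in>P. ?B) \<le> (\<Sum>x\<in>P. ?m (hull_cone P x) + (\<Sum>s\<in>S. ?m (vcone ?Z x s)))"
    by (rule sum_mono)
  also have "\<dots> = (\<Sum>x\<in>P. ?m (hull_cone P x)) + (\<Sum>s\<in>S. \<Sum>x\<in>P. ?m (vcone ?Z x s))"
    by (simp add: sum.distrib sum.swap[of _ S])
  \<comment> \<open>All outer normals together fill at most one ball; this is the \<open>+ 1\<close>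
    of the conclusion.\<close>
  also have "(\<Sum>x\<in>P. ?m (hull_cone P x)) \<le> ?B"
    using fin by (intro sum_measure_le_ball hull_cone_lmeasurable hull_cone_subset_ball)
      (auto simp: pairwise_def negligible_hull_cone_Int)
  \<comment> \<open>Reflection moves each angle from \<open>x\<close> to \<open>s\<close>, where the
    cones overlap only in null sets.\<close>
  also have "(\<Sum>s\<in>S. \<Sum>x\<in>P. ?m (vcone ?Z x s)) \<le> (\<Sum>s\<in>S. \<Sum>x\<in>P. ?m (vcone ?Z s x))"
    using disj by (intro sum_mono measure_vcone_le) auto
  also have "\<dots> \<le> (\<Sum>s\<in>S. ?B)"
  proof (rule sum_mono)
    fix s assume s: "s \<in> S"
    have "negligible (vcone ?Z s x \<inter> vcone ?Z s y)" if "x \<in> P" "y \<in> P" "x \<noteq> y" for x y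
      using that s disj by (intro negligible_vcone_Int) auto
    then show "(\<Sum>x\<in>P. ?m (vcone ?Z s x)) \<le> ?B"
      using fin by (intro sum_measure_le_ball vcone_lmeasurable vcone_subset_ball) (auto simp: pairwise_def)
  qed
  finally have "real (card P) * ?B \<le> (1 + real (card S)) * ?B" by (simp add: algebra_simps)
  then have "real (card P) \<le> 1 + real (card S)" using B by (simp only: mult_le_cancel_right_pos)
  then show ?thesis by linarith
qed

section \<open>Packings and the greedy choice\<close>

lemma finite_pos_lower_bound:
  fixes f :: "'i \<Rightarrow> real"
  assumes "finite I" "\<And>i. i \<in> I \<Longrightarrow> f i > 0"
  shows "\<exists>e>0. \<forall>i\<in>I. e \<le> f i"
  using assms
proof (induction I rule: finite_induct)
  case (insert i I)
  then obtain e where "e > 0" "\<forall>j\<in>I. e \<le> f j" by auto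
  then show ?case using insert.prems by (intro exI[of _ "min e (f i)"]) auto
qed (auto intro: exI[of _ 1])

lemma finite_imp_separated:
  fixes P :: "'a::metric_space set"
  assumes "finite P"
  shows "\<exists>e>0. \<forall>x\<in>P. \<forall>y\<in>P. x \<noteq> y \<longrightarrow> e \<le> dist x y"
proof -
  have "\<exists>e>0. \<forall>p\<in>{p \<in> P \<times> P. fst p \<noteq> snd p}. e \<le> dist (fst p) (snd p)"
    using assms by (intro finite_pos_lower_bound) auto
  then show ?thesis by force
qed

abbreviation disk :: "'a::metric_space \<times> real \<Rightarrow> 'a set" where
  "disk K \<equiv> cball (fst K) (snd K)"

text \<open>Closed disks are kept disjoint, not just interiors, so that no point of \<open>P\<close>
  lies on two of the circles.\<close>

definition packing :: "'a::metric_space set \<Rightarrow> ('a \<times> real) set \<Rightarrow> bool" where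
  "packing P F \<longleftrightarrow> (\<forall>K\<in>F. good_disk P (fst K) (snd K)) \<and> pairwise (\<lambda>K E. disjnt (disk K) (disk E)) F"

lemma packing_card:
  assumes "finite P" "packing P F"
  shows "finite F" "2 * card F \<le> card {p \<in> P. \<exists>K\<in>F. p \<in> sphere (fst K) (snd K)}"
proof -
  let ?pts = "\<lambda>K. P \<inter> sphere (fst K) (snd K)"
  have two: "2 \<le> card (?pts K)" if "K \<in> F" for K
  proof -
    obtain a b where "a \<in> ?pts K" "b \<in> ?pts K" "a \<noteq> b"
      using assms(2) \<open>K \<in> F\<close> by (fastforce simp: packing_def good_disk_def)
    then have "card {a, b} \<le> card (?pts K)" using assms(1) by (intro card_mono) auto
    then show ?thesis using \<open>a \<noteq> b\<close> by simp
  qed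
  have disj: "?pts K \<inter> ?pts E = {}" if "K \<in> F" "E \<in> F" "K \<noteq> E" for K E
    using assms(2) that sphere_cball unfolding packing_def pairwise_def disjnt_def by fastforce
  \<comment> \<open>Finiteness of \<open>F\<close>: each disk is determined by its nonempty set of
    boundary points, a subset of \<open>P\<close>.\<close>
  have "inj_on ?pts F"
  proof (rule inj_onI, rule ccontr)
    fix K E assume *: "K \<in> F" "E \<in> F" "?pts K = ?pts E" "K \<noteq> E"
    then have "?pts K = {}" using disj[of K E] by simp
    then show False using two[OF *(1)] by simp
  qed
  moreover have "finite (?pts ` F)"
    by (rule finite_subset[of _ "Pow P"]) (use assms(1) in auto)
  ultimately show fin: "finite F" by (rule finite_imageD[rotated])
  have "2 * card F = (\<Sum>K\<in>F. 2)" by simp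
  also have "\<dots> \<le> (\<Sum>K\<in>F. card (?pts K))" using two by (rule sum_mono)
  also have "\<dots> = card (\<Union>K\<in>F. ?pts K)"
    using fin assms(1) disj by (intro card_UN_disjoint[symmetric]) auto
  also have "(\<Union>K\<in>F. ?pts K) = {p \<in> P. \<exists>K\<in>F. p \<in> sphere (fst K) (snd K)}" by force
  finally show "2 * card F \<le> card {p \<in> P. \<exists>K\<in>F. p \<in> sphere (fst K) (snd K)}" .
qed

text \<open>The infimum of the radii need not be attained when \<open>Q\<close> demands disjointness
  from closed disks. It is positive, because a good disk has two separated points on its boundary,
  so the factor \<open>q > 1\<close> leaves room.\<close>

lemma almost_smallest_good_disk:
  assumes "finite P" "q > 1" and ex: "good_disk P z R" "Q z R"
  obtains c r where "good_disk P c r" "Q c r"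
    "\<And>z R. good_disk P z R \<Longrightarrow> Q z R \<Longrightarrow> r \<le> q * R"
proof -
  obtain e where e: "e > 0" "\<forall>x\<in>P. \<forall>y\<in>P. x \<noteq> y \<longrightarrow> e \<le> dist x y"
    using finite_imp_separated[OF assms(1)] by blast
  let ?A = "{R. \<exists>z. good_disk P z R \<and> Q z R}"
  have low: "e / 2 \<le> R" if R: "R \<in> ?A" for R
  proof -
    obtain z a b where "a \<in> P" "b \<in> P" "a \<noteq> b" "dist z a = R" "dist z b = R"
      using R by (auto simp: good_disk_def)
    moreover have "dist a b \<le> dist z a + dist z b" by (rule dist_triangle3)
    ultimately show ?thesis using e(2) by force
  qed
  have ne: "?A \<noteq> {}" using ex by blast
  have bdd: "bdd_below ?A" using low by (intro bdd_belowI)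
  have pos: "0 < Inf ?A" using cInf_greatest[OF ne low] e(1) by linarith
  then have "Inf ?A < q * Inf ?A" using assms(2) by simp
  then obtain r where r: "r \<in> ?A" "r < q * Inf ?A"
    using ne bdd by (subst (asm) cInf_less_iff) auto
  then obtain c where c: "good_disk P c r" "Q c r" by blast
  have "r \<le> q * R" if "good_disk P z R" "Q z R" for z R
  proof -
    have "Inf ?A \<le> R" using bdd that by (intro cInf_lower) auto
    then have "q * Inf ?A \<le> q * R" using assms(2) by simp
    then show ?thesis using r by linarith
  qed
  with c show ?thesis using that by blast
qed

text \<open>In place of an iteration, take a largest packing with the invariant
  \<open>greedy\<close>. If some good disk were still free, adding an almost smallest free one would
  keep the invariant.\<close>

lemma greedy_packing:
  assumes "finite P" "q > 1"
  obtains F where "packing P F"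
    "\<And>z R. good_disk P z R \<Longrightarrow> \<exists>K\<in>F. \<not> disjnt (cball z R) (disk K) \<and> snd K \<le> q * R"
proof -
  define free where "free F z R \<longleftrightarrow> (\<forall>K\<in>F. disjnt (cball z R) (disk K))"
    for F :: "('a \<times> real) set" and z R
  define greedy where "greedy F \<longleftrightarrow> packing P F \<and> (\<forall>z R. good_disk P z R \<longrightarrow>
      free F z R \<or> (\<exists>K\<in>F. \<not> disjnt (cball z R) (disk K) \<and> snd K \<le> q * R))" for F
  have "greedy {}" by (simp add: greedy_def packing_def free_def)
  moreover have "\<forall>F. greedy F \<longrightarrow> card F < Suc (card P)"
  proof (intro allI impI)
    fix F assume "greedy F"
    then have "2 * card F \<le> card {p \<in> P. \<exists>K\<in>F. p \<in> sphere (fst K) (snd K)}"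
      using packing_card(2)[OF assms(1)] by (simp add: greedy_def)
    also have "\<dots> \<le> card P" using assms(1) by (intro card_mono) auto
    finally show "card F < Suc (card P)" by simp
  qed
  ultimately obtain F where F: "greedy F" and max: "\<And>F'. greedy F' \<Longrightarrow> card F' \<le> card F"
    using ex_has_greatest_nat[of greedy "{}" card "Suc (card P)"] by blast
  have pF: "packing P F" using F by (simp add: greedy_def)
  have no_free: "\<not> free F z R" if gz: "good_disk P z R" for z R
  proof
    assume "free F z R"
    then obtain c r where c: "good_disk P c r" "free F c r"
      "\<And>z R. good_disk P z R \<Longrightarrow> free F z R \<Longrightarrow> r \<le> q * R"
      using almost_smallest_good_disk[OF assms gz, of "free F"] by blast
    let ?F = "insert (c, r) F"
    have r: "r > 0" using c(1) by (simp add: good_disk_def)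
    have "(c, r) \<notin> F"
      using c(2) r by (auto simp: free_def disjnt_iff dest!: bspec spec[of _ c])
    then have "card ?F = Suc (card F)"
      using packing_card(1)[OF assms(1) pF] by simp
    moreover have "greedy ?F"
      unfolding greedy_def
    proof (intro conjI allI impI)
      show "packing P ?F"
        using pF c(1,2) by (auto simp: packing_def pairwise_insert free_def disjnt_sym)
      fix z R assume "good_disk P z R"
      \<comment> \<open>A disk that only \<open>(c, r)\<close> obstructs was free before, so
        \<open>r\<close> is at most \<open>q\<close> times its radius.\<close>
      then show "free ?F z R \<or> (\<exists>K\<in>?F. \<not> disjnt (cball z R) (disk K) \<and> snd K \<le> q * R)"
        using F c(3)[of z R] unfolding greedy_def free_def by auto
    qed
    ultimately show False using max[of ?F] by simp
  qed
  show ?thesis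
    by (rule that[OF pF]) (use F no_free in \<open>auto simp: greedy_def\<close>)
qed

section \<open>Eight points that hit nearby disks\<close>

text \<open>\<open>cos (\<pi> / 7)\<close> is a root of \<open>8 c\<^sup>3 - 4 c\<^sup>2 - 4 c + 1\<close>, which is negative on \<open>[1 / 2, 89 / 100]\<close>.\<close>

lemma cos_pi_7_ge: "cos (pi / 7) \<ge> 89 / 100"
proof (rule ccontr)
  define c where "c = cos (pi / 7)"
  assume "\<not> ?thesis"
  then have less: "c < 89 / 100" by (simp add: c_def)
  have "cos (pi / 3) < cos (pi / 7)" by (rule cos_monotone_0_pi) auto
  then have half: "c > 1 / 2" by (simp add: c_def cos_60)
  \<comment> \<open>Four times \<open>pi / 7\<close> is \<open>pi\<close> minus three times it,
    which gives a quartic in \<open>c\<close> with the spurious factor \<open>c + 1\<close>.\<close>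
  have "cos (2 * (2 * (pi / 7))) = cos (pi - 3 * (pi / 7))" by (rule arg_cong[of _ _ cos]) simp
  also have "\<dots> = - cos (3 * (pi / 7))" by (rule cos_pi_minus)
  finally have "cos (2 * (2 * (pi / 7))) = - cos (3 * (pi / 7))" .
  then have "2 * (2 * c\<^sup>2 - 1)\<^sup>2 - 1 = - (4 * c ^ 3 - 3 * c)"
    by (simp only: cos_double_cos cos_treble_cos c_def)
  then have "(c + 1) * (8 * c ^ 3 - 4 * c\<^sup>2 - 4 * c + 1) = 0" by algebra
  then have root: "8 * c ^ 3 - 4 * c\<^sup>2 - 4 * c + 1 = 0" using half by simp
  \<comment> \<open>Subtracting 2500 times the cubic from the product formed next leaves
    \<open>5421 - 5842 * c \<le> 0\<close>, contrary to \<open>c < 89 / 100\<close>.\<close>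
  have "(2 * c - 1) * (100 * c - 89) \<le> 0" using less half by (intro mult_nonneg_nonpos) auto
  then have "(2 * c - 1) * (100 * c - 89) * (100 * c + 89) \<le> 0"
    by (rule mult_nonpos_nonneg) (use half in simp)
  then have "20000 * c ^ 3 - 10000 * c\<^sup>2 - 15842 * c + 7921 \<le> 0"
    by (simp add: algebra_simps power2_eq_square power3_eq_cube)
  then show False using root less by linarith
qed

definition dir :: "real \<Rightarrow> real ^ 2" where
  "dir t = vector [cos t, sin t]"

lemma inner_dir: "dir s \<bullet> dir t = cos (s - t)"
  by (simp add: dir_def inner_vec_def sum_2 cos_diff)

lemma norm_dir [simp]: "norm (dir t) = 1"
  by (simp add: norm_eq_sqrt_inner inner_dir)

lemma polar_decomposition:
  fixes v :: "real ^ 2"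
  obtains t where "0 \<le> t" "t < 2 * pi" "v = norm v *\<^sub>R dir t"
proof (cases "v = 0")
  case True
  then show ?thesis using that[of 0] by simp
next
  case False
  have "(norm v)\<^sup>2 = v \<bullet> v" by (rule power2_norm_eq_inner)
  also have "\<dots> = (v $ 1)\<^sup>2 + (v $ 2)\<^sup>2"
    by (simp add: inner_vec_def sum_2 power2_eq_square)
  finally have n: "(norm v)\<^sup>2 = (v $ 1)\<^sup>2 + (v $ 2)\<^sup>2" .
  have "(v $ 1 / norm v)\<^sup>2 + (v $ 2 / norm v)\<^sup>2 = 1"
    using False by (simp add: power_divide flip: add_divide_distrib n)
  then obtain t where t: "0 \<le> t" "t < 2 * pi" "v $ 1 / norm v = cos t" "v $ 2 / norm v = sin t"
    by (rule sincos_total_2pi)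
  have "v = norm v *\<^sub>R dir t"
    using False by (simp add: vec_eq_iff forall_2 dir_def flip: t(3,4))
  then show ?thesis using that t by blast
qed

text \<open>Rounding to the nearest multiple of \<open>2 * pi / 7\<close> costs an angle of at most
  \<open>pi / 7\<close>.\<close>

lemma heptagon_direction:
  assumes "0 \<le> t" "t < 2 * pi"
  obtains k :: nat where "k < 7" "cos (t - 2 * pi * real k / 7) \<ge> 89 / 100"
proof -
  define k where "k = nat \<lfloor>7 * t / (2 * pi) + 1 / 2\<rfloor>"
  have k_eq: "real k = of_int \<lfloor>7 * t / (2 * pi) + 1 / 2\<rfloor>"
    using assms by (simp add: k_def add_nonneg_nonneg)
  have bnd: "\<bar>7 * t / (2 * pi) - real k\<bar> \<le> 1 / 2"
    unfolding k_eq by linarith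
  have eq: "t - 2 * pi * real k / 7 = (7 * t / (2 * pi) - real k) * (2 * pi / 7)"
    by (simp add: field_simps)
  have "\<bar>t - 2 * pi * real k / 7\<bar> = \<bar>7 * t / (2 * pi) - real k\<bar> * \<bar>2 * pi / 7\<bar>"
    unfolding eq by (rule abs_mult)
  also have "\<dots> \<le> 1 / 2 * \<bar>2 * pi / 7\<bar>" using bnd by (intro mult_right_mono) auto
  finally have "\<bar>t - 2 * pi * real k / 7\<bar> \<le> pi / 7" by simp
  then have "cos (pi / 7) \<le> cos \<bar>t - 2 * pi * real k / 7\<bar>"
    by (intro cos_monotone_0_pi_le) auto
  then have c: "cos (t - 2 * pi * real k / 7) \<ge> 89 / 100" using cos_pi_7_ge by simp
  have "7 * t / (2 * pi) < 7" using assms by (simp add: field_simps)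
  \<comment> \<open>Angles just below \<open>2 * pi\<close> round to \<open>k = 7\<close>, which is
    the same direction as \<open>k = 0\<close>.\<close>
  then have "real k < 8" using bnd by linarith
  then consider "k < 7" | "k = 7" by linarith
  then show ?thesis
  proof cases
    case 2
    then have "cos (t - 2 * pi * real 0 / 7) \<ge> 89 / 100" using c by (simp add: cos_diff)
    then show ?thesis using that[of 0] by simp
  qed (use that c in blast)
qed

text \<open>A centre and seven points around it: eight unit disks arranged like this cover a disk of radius
  larger than \<open>2\<close>, which leaves room for the factor \<open>21 / 20\<close> lost by the greedy choice.
  Here \<open>34 / 21 = 17 / 10 \<cdot> 20 / 21\<close>.\<close>

definition sample_points :: "(real ^ 2) \<times> real \<Rightarrow> (real ^ 2) set" where
  "sample_points K = insert (fst K)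
     ((\<lambda>k. fst K + (34 / 21 * snd K) *\<^sub>R dir (2 * pi * real k / 7)) ` {..<7::nat})"

lemma card_sample_points: "finite (sample_points K)" "card (sample_points K) \<le> 8"
proof -
  let ?f = "\<lambda>k. fst K + (34 / 21 * snd K) *\<^sub>R dir (2 * pi * real k / 7)"
  show "finite (sample_points K)" by (simp add: sample_points_def)
  have "card (sample_points K) \<le> Suc (card (?f ` {..<7::nat}))"
    unfolding sample_points_def by (rule card_insert_le_m1) auto
  also have "card (?f ` {..<7::nat}) \<le> card {..<7::nat}" by (rule card_image_le) simp
  finally show "card (sample_points K) \<le> 8" by simp
qed

text \<open>If the centre \<open>c\<close> misses the open disk, shrink the disk to radius
  \<open>b\<close>, keeping its far side off: the new centre \<open>y\<close> lies on the segment
  from \<open>c\<close> to \<open>z\<close>. The law of cosines then bounds its distance to the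
  heptagon point nearest in direction.\<close>

lemma sample_points_hit:
  assumes "r > 0" "r \<le> 21 / 20 * R" "dist z c \<le> R + r"
  shows "\<exists>s\<in>sample_points (c, r). dist z s < R"
proof (cases "dist z c < R")
  case False
  define b where "b = 20 / 21 * r"
  define d where "d = dist z c - (R - b)"
    \<comment> \<open>A disk of radius \<open>b\<close> inside the given one, at distance \<open>d\<close> from \<open>c\<close>, already contains a sample point.\<close>
  have b: "0 < b" "b \<le> R" "r = 21 / 20 * b" using assms by (simp_all add: b_def)
  have d: "b \<le> d" "d \<le> 41 / 20 * b" using False assms b by (auto simp: d_def)
  obtain t where t: "0 \<le> t" "t < 2 * pi" "z - c = norm (z - c) *\<^sub>R dir t"
    by (rule polar_decomposition)
  obtain k :: nat where k: "k < 7" "cos (t - 2 * pi * real k / 7) \<ge> 89 / 100"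
    using heptagon_direction[OF t(1,2)] by blast
  define u where "u = 2 * pi * real k / 7"
  define y where "y = c + d *\<^sub>R dir t"
  define s where "s = c + (34 / 21 * r) *\<^sub>R dir u"
  have s_in: "s \<in> sample_points (c, r)" using k by (auto simp: sample_points_def s_def u_def)
  have z: "z = c + dist z c *\<^sub>R dir t"
    using t(3) by (metis add.commute diff_add_cancel dist_norm)
  have "z - y = (R - b) *\<^sub>R dir t"
    by (subst z) (simp add: y_def d_def algebra_simps)
  then have zy: "dist z y = R - b" using b by (simp add: dist_norm)
  let ?x = "d *\<^sub>R dir t" and ?y = "(17 / 10 * b) *\<^sub>R dir u"
  have "(norm (?x - ?y))\<^sup>2 = (?x - ?y) \<bullet> (?x - ?y)" by (rule power2_norm_eq_inner)
  also have "\<dots> = d\<^sup>2 + (17 / 10 * b)\<^sup>2 - 2 * d * (17 / 10 * b) * cos (t - u)"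
    by (simp add: inner_diff_left inner_diff_right inner_dir cos_diff power2_eq_square algebra_simps)
  finally have "(norm (?x - ?y))\<^sup>2 = \<dots>" .
  moreover have "y - s = d *\<^sub>R dir t - (17 / 10 * b) *\<^sub>R dir u"
    using b by (simp add: y_def s_def)
  then have "norm (?x - ?y) = dist y s" by (simp add: dist_norm)
  ultimately have ys: "(dist y s)\<^sup>2 = d\<^sup>2 + 289 / 100 * b\<^sup>2 - 34 / 10 * (d * b) * cos (t - u)"
    by (simp add: power_mult_distrib power2_eq_square)
  have db: "0 < d * b" using d b by simp
  have "34 / 10 * (d * b) * (89 / 100) \<le> 34 / 10 * (d * b) * cos (t - u)"
    using k db by (intro mult_left_mono) (auto simp: u_def)
  \<comment> \<open>By convexity, \<open>d\<^sup>2\<close> lies below its chord over the range of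
    \<open>d\<close>. The final bound is then \<open>8892 / 10000 * b\<^sup>2\<close>.\<close>
  moreover have "(d - b) * (d - 41 / 20 * b) \<le> 0" using d by (simp add: mult_le_0_iff)
  then have "d\<^sup>2 \<le> 61 / 20 * (d * b) - 41 / 20 * b\<^sup>2"
    by (simp add: field_simps power2_eq_square)
  moreover have "d * b \<le> 41 / 20 * b\<^sup>2"
    using mult_right_mono[OF d(2), of b] b by (simp add: power2_eq_square)
  moreover have "0 < b\<^sup>2" using b by simp
  ultimately have "(dist y s)\<^sup>2 < b\<^sup>2" using ys by linarith
  then have "dist y s < b" using b by (meson less_imp_le power2_less_imp_less)
  then have "dist z s < R" using dist_triangle[of z s y] zy by linarith
  then show ?thesis using s_in by blast
qed (auto simp: sample_points_def)

section \<open>From packings to disk covers\<close>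

lemma large_packing:
  fixes P :: "(real ^ 2) set"
  assumes "finite P"
  shows "\<exists>F. packing P F \<and> card P \<le> 8 * card F + 1"
proof -
  obtain F where F: "packing P F"
    and meet: "\<And>z R. good_disk P z R \<Longrightarrow>
      \<exists>K\<in>F. \<not> disjnt (cball z R) (disk K) \<and> snd K \<le> 21 / 20 * R"
    using greedy_packing[OF assms, of "21 / 20"] by auto
  have fin: "finite F" by (rule packing_card(1)[OF assms F])
  \<comment> \<open>Blockers must avoid \<open>P\<close>; dropping \<open>P\<close> is harmless,
    since a sample point inside a good disk is never in \<open>P\<close>.\<close>
  let ?S = "(\<Union>K\<in>F. sample_points K) - P"
  have "\<exists>s\<in>?S. dist z s < R" if good: "good_disk P z R" for z R
  proof -
    obtain K where K: "K \<in> F" "\<not> disjnt (cball z R) (disk K)" "snd K \<le> 21 / 20 * R"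
      using meet[OF good] by blast
    then obtain x where "dist z x \<le> R" "dist (fst K) x \<le> snd K" by (auto simp: disjnt_iff)
    then have "dist z (fst K) \<le> R + snd K" using dist_triangle2[of z "fst K" x] by linarith
    moreover have "snd K > 0" using F K(1) by (simp add: packing_def good_disk_def)
    ultimately obtain s where "s \<in> sample_points K" "dist z s < R"
      using sample_points_hit[of "snd K" R z "fst K"] K(3) by auto
    moreover from this have "s \<notin> P" using good by (force simp: good_disk_def)
    ultimately show ?thesis using K(1) by blast
  qed
  then have "card P \<le> card ?S + 1"
    using assms fin by (intro card_le_blockers) (auto simp: card_sample_points)
  also have "card ?S \<le> card (\<Union>K\<in>F. sample_points K)"
    using fin by (intro card_mono) (auto simp: card_sample_points)
  also have "\<dots> \<le> (\<Sum>K\<in>F. card (sample_points K))" by (rule card_UN_le[OF fin])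
  also have "\<dots> \<le> (\<Sum>K\<in>F. 8)" by (intro sum_mono card_sample_points)
  finally show ?thesis using F by (auto simp: mult.commute)
qed

text \<open>Each packing disk serves at least two points at the price of one; every remaining point
  gets a tiny disk of its own.\<close>

lemma D_set_packing:
  assumes fin: "finite P" and F: "packing P F"
  shows "D_set P + card F \<le> card P"
proof -
  let ?Cov = "{p \<in> P. \<exists>K\<in>F. p \<in> sphere (fst K) (snd K)}"
  let ?U = "P - ?Cov"
  note finF = packing_card(1)[OF fin F]
  have good: "snd K > 0" "\<And>p. p \<in> P \<Longrightarrow> snd K \<le> dist (fst K) p" if "K \<in> F" for K
    using F that by (auto simp: packing_def good_disk_def)
  obtain d where d: "d > 0" "\<forall>x\<in>P. \<forall>y\<in>P. x \<noteq> y \<longrightarrow> d \<le> dist x y"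
    using finite_imp_separated[OF fin] by blast
  have "\<exists>e>0. \<forall>p\<in>?U \<times> F. e \<le> dist (fst (snd p)) (fst p) - snd (snd p)"
    using fin finF good(2) by (intro finite_pos_lower_bound) (force simp: less_le)+
  then obtain e where e: "e > 0" "\<And>u K. u \<in> ?U \<Longrightarrow> K \<in> F \<Longrightarrow> snd K + e \<le> dist (fst K) u"
    by force
  define h where "h = min d e / 4"
  have h: "h > 0" "4 * h \<le> d" "4 * h \<le> e" using d e by (auto simp: h_def)
  define v :: "real ^ 2" where "v = h *\<^sub>R axis 1 1"
  have nv: "norm v = h" using h by (simp add: v_def)
  let ?T = "\<lambda>u. cball (u + v) h"
  have near: "dist u x < 2 * h" if "x \<in> ball (u + v) h" for u x
    using dist_triangle[of u x "u + v"] that nv by (simp add: dist_norm)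
  let ?G = "disk ` F \<union> ?T ` ?U"
  have "disk_cover P ?G"
    unfolding disk_cover_def
  proof (intro conjI ballI)
    show "finite ?G" using fin finF by simp
    fix A assume "A \<in> ?G"
    then show "empty_disk P A"
    proof
      assume "A \<in> disk ` F"
      then obtain K where "K \<in> F" "A = disk K" by auto
      then show ?thesis
        using good[of K] by (force simp: empty_disk_def is_disk_def interior_cball)
    next
      assume "A \<in> ?T ` ?U"
      then obtain u where u: "u \<in> ?U" "A = ?T u" by auto
      have "q \<notin> P" if q: "q \<in> ball (u + v) h" for q
      proof
        assume "q \<in> P"
        moreover have "q \<noteq> u" using q nv by (auto simp: dist_norm)
        ultimately show False using d(2) u(1) near[OF q] h by force
      qed
      then show ?thesis
        using u h by (auto simp: empty_disk_def is_disk_def interior_cball)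
    qed
  next
    have disj_FF: "disjnt (interior (disk K)) (interior (disk E))" if "K \<in> F" "E \<in> F" "disk K \<noteq> disk E" for K E
    proof -
      have "disjnt (disk K) (disk E)"
        using F that by (auto simp: packing_def pairwise_def)
      then show ?thesis by (meson disjnt_subset1 disjnt_subset2 interior_subset)
    qed
    have disj_FT: "disjnt (interior (disk K)) (interior (?T u))" if K: "K \<in> F" and u: "u \<in> ?U" for K u
    proof (rule ccontr)
      assume "\<not> ?thesis"
      then obtain x where "dist (fst K) x < snd K" "x \<in> ball (u + v) h"
        by (auto simp: disjnt_iff interior_cball)
      then show False
        using near[of x u] e(2)[OF u K] h dist_triangle2[of "fst K" u x] by linarith
    qed
    have disj_TT: "disjnt (interior (?T u)) (interior (?T w))" if uw: "u \<in> ?U" "w \<in> ?U" "?T u \<noteq> ?T w" for u w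
    proof (rule ccontr)
      assume "\<not> ?thesis"
      then obtain x where "x \<in> ball (u + v) h" "x \<in> ball (w + v) h"
        by (auto simp: disjnt_iff interior_cball)
      then have "dist u w < 4 * h"
        using near[of x u] near[of x w] dist_triangle2[of u w x] by linarith
      then show False using d(2) uw h by force
    qed
    have "disjnt (interior A) (interior B)" if AB: "A \<in> ?G" "B \<in> ?G" "A \<noteq> B" for A B
    proof -
      consider (FF) K E where "K \<in> F" "E \<in> F" "A = disk K" "B = disk E"
        | (FT) K u where "K \<in> F" "u \<in> ?U" "A = disk K" "B = ?T u"
        | (TF) K u where "K \<in> F" "u \<in> ?U" "A = ?T u" "B = disk K"
        | (TT) u w where "u \<in> ?U" "w \<in> ?U" "A = ?T u" "B = ?T w"
        using AB(1,2) by (elim UnE imageE) blast+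
      then show ?thesis
      proof cases
        case FF
        then show ?thesis using disj_FF[of K E] AB(3) by blast
      next
        case FT
        show ?thesis unfolding FT(3,4) by (rule disj_FT[OF FT(1,2)])
      next
        case TF
        show ?thesis unfolding TF(3,4) by (rule disjnt_sym[OF disj_FT[OF TF(1,2)]])
      next
        case TT
        then show ?thesis using disj_TT[of u w] AB(3) by blast
      qed
    qed
    then show "disjoint_disks ?G" by (simp add: disjoint_disks_def pairwise_def)
  next
    fix p assume p: "p \<in> P"
    show "\<exists>A\<in>?G. p \<in> frontier A"
    proof (cases "p \<in> ?Cov")
      case True
      then show ?thesis by (force simp: frontier_cball)
    next
      case False
      have "p \<in> frontier (?T p)" using h nv by (simp add: frontier_cball dist_norm)
      then show ?thesis using p False by blast
    qed
  qed
  then have "D_set P \<le> card ?G" by (rule D_set_le)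
  also have "\<dots> \<le> card (disk ` F) + card (?T ` ?U)" by (rule card_Un_le)
  also have "\<dots> \<le> card F + card ?U"
    using fin finF by (intro add_mono card_image_le) auto
  also have "card ?U = card P - card ?Cov" using fin by (intro card_Diff_subset) auto
  finally have "D_set P \<le> card F + (card P - card ?Cov)" .
  moreover have "card ?Cov \<le> card P" using fin by (intro card_mono) auto
  ultimately show ?thesis using packing_card(2)[OF fin F] by linarith
qed

theorem proposition2:
  "\<exists>C::real. \<forall>n::nat. n \<ge> 1 \<longrightarrow> real (D n) \<le> 7 * real n / 8 + C"
proof (intro exI[of _ "1 / 8"] allI impI)
  fix n :: nat
  obtain P where P: "finite P" "card P = n" "D_set P = D n" using D_attained by blast
  obtain F where F: "packing P F" "card P \<le> 8 * card F + 1"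
    using large_packing[OF P(1)] by blast
  have "D n + card F \<le> n" "n \<le> 8 * card F + 1"
    using D_set_packing[OF P(1) F(1)] F(2) P by auto
  \<comment> \<open>Eliminating \<open>card F\<close> gives
    \<open>D n \<le> n - (n - 1) / 8\<close>, hence the constant \<open>1 / 8\<close>.\<close>
  then show "real (D n) \<le> 7 * real n / 8 + 1 / 8" by (simp add: field_simps)
qed

end
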